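(* Let $T$ be a rooted $\mathbb{R}$-special tree. Then its road space $R_T$ is contractible.
   Context: A tree $T$ is a partially ordered set such that the set of predecessors of each point is well ordered. Trees are assumed to be Hausdorff: if $x,y\in T$ are at a limit level and have the same predecessors, then $x=y$. A tree is rooted iff it has a unique minimal element (the root). Trees carry the order (interval) topology. A tree $T$ is $\mathbb{R}$-special iff there is a strictly increasing (not necessarily continuous) function $T\to\mathbb{R}$. Road space. The road space $R_T$ of a tree $T$ is obtained from $T$ by joining each pair of consecutive points $x<y$ of $T$ (that is, $y$ is an immediate successor of $x$) by a copy ${}_x[0,1]_y$ of the interval $[0,1]$, with $0$ glued to $x$ and $1$ glued to $y$; the order of $T$ is extended to $R_T$ in the obvious way. For $A\subset[0,1]$, ${}_xA_y$ denotes the corresponding subset of ${}_x[0,1]_y$. $T$ is regarded as a subset of $R_T$. For $x\in T$ let $s(x)$ be the set of its immediate successors and, for $n\ge 1$, $W_{x,n}=\{x\}\cup\bigcup_{y\in s(x)}{}_x[0,1/n)_y$. The topology of $R_T$ is as follows. The interior ${}_x(0,1)_y$ of each added interval is open and has the usual topology of $(0,1)$. If $x\in s(z)$ with $z\in T$, a neighborhood base at $x$ is $\{W_{x,n}\cup{}_z(1-1/n,1]_x : n\ge 1\}$. If $x$ is minimal in $T$, a neighborhood base at $x$ is $\{W_{x,n}: n\ge1\}$. If $x\in T$ is at a limit level, a neighborhood base at $x$ is given by the sets $\{y\in R_T: z<y\le x\}\cup\bigcup\{W_{w,n}: w\in T,\ z<w\le x\}$ for $z\in T$, $z<x$, $n\ge1$.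 A space $X$ is contractible if there is a continuous $h\colon X\times[0,1]\to X$ such that $h(x,1)=x$ for all $x\in X$ and $h(\cdot,0)$ is constant. *)

theory Defs
  imports "HOL-Analysis.Analysis"
begin

section \<open>Trees\<close>

text \<open>A tree is a set \<open>T\<close> carrying the partial order of its ambient type. Only points of \<open>T\<close>
  count in the notions below.\<close>

definition preds :: "'a::order set \<Rightarrow> 'a \<Rightarrow> 'a set" where
  "preds T x = {y \<in> T. y < x}"

definition succs :: "'a::order set \<Rightarrow> 'a \<Rightarrow> 'a set" where
  "succs T x = {y \<in> T. x < y \<and> \<not> (\<exists>w\<in>T. x < w \<and> w < y)}"

definition minimal_in :: "'a::order set \<Rightarrow> 'a \<Rightarrow> bool" where
  "minimal_in T x \<longleftrightarrow> x \<in> T \<and> \<not> (\<exists>y\<in>T. y < x)"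

text \<open>The level of \<open>x\<close> is the order type of \<open>preds T x\<close>. It is a limit ordinal (in particular
  nonzero) iff this set is nonempty and has no greatest element.\<close>

definition limit_level :: "'a::order set \<Rightarrow> 'a \<Rightarrow> bool" where
  "limit_level T x \<longleftrightarrow>
     x \<in> T \<and> preds T x \<noteq> {} \<and> \<not> (\<exists>m\<in>preds T x. \<forall>y\<in>preds T x. y \<le> m)"

definition hausdorff_tree :: "'a::order set \<Rightarrow> bool" where
  "hausdorff_tree T \<longleftrightarrow>
     (\<forall>x\<in>T. well_order_on (preds T x) {(a, b) \<in> preds T x \<times> preds T x. a \<le> b}) \<and>
     (\<forall>x\<in>T. \<forall>y\<in>T. limit_level T x \<and> limit_level T y \<and> preds T x = preds T y \<longrightarrow> x = y)"

definition rooted :: "'a::order set \<Rightarrow> bool" where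
  "rooted T \<longleftrightarrow> (\<exists>!r. minimal_in T r)"

definition R_special :: "'a::order set \<Rightarrow> bool" where
  "R_special T \<longleftrightarrow> (\<exists>f :: 'a \<Rightarrow> real. strict_mono_on T f)"

section \<open>The road space\<close>

text \<open>\<open>Vertex x\<close> is the point \<open>x\<close> of \<open>T\<close>; \<open>Edge x y t\<close> with \<open>y \<in> succs T x\<close> and \<open>0 < t < 1\<close> is the
  point with parameter \<open>t\<close> in the interval joining \<open>x\<close> to \<open>y\<close>. The end points of the intervals
  are not duplicated: the map \<open>seg x y\<close> on \<open>[0,1]\<close> carries out the gluing, so that
  \<open>seg x y ` A\<close> is the subset \<open>\<^sub>xA\<^sub>y\<close> of the interval joining \<open>x\<close> to \<open>y\<close>.\<close>

datatype 'a road = Vertex 'a | Edge 'a 'a real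

definition road_points :: "'a::order set \<Rightarrow> 'a road set" where
  "road_points T = Vertex ` T \<union> {Edge x y t | x y t. x \<in> T \<and> y \<in> succs T x \<and> 0 < t \<and> t < 1}"

definition seg :: "'a \<Rightarrow> 'a \<Rightarrow> real \<Rightarrow> 'a road" where
  "seg x y t = (if t = 0 then Vertex x else if t = 1 then Vertex y else Edge x y t)"

fun road_less :: "'a::order road \<Rightarrow> 'a road \<Rightarrow> bool" where
  "road_less (Vertex x) (Vertex y) \<longleftrightarrow> x < y"
| "road_less (Vertex x) (Edge u v t) \<longleftrightarrow> x \<le> u"
| "road_less (Edge u v t) (Vertex y) \<longleftrightarrow> v \<le> y"
| "road_less (Edge u v t) (Edge u' v' t') \<longleftrightarrow> v \<le> u' \<or> (u = u' \<and> v = v' \<and> t < t')"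

definition road_le :: "'a::order road \<Rightarrow> 'a road \<Rightarrow> bool" where
  "road_le p q \<longleftrightarrow> road_less p q \<or> p = q"

definition W_set :: "'a::order set \<Rightarrow> 'a \<Rightarrow> nat \<Rightarrow> 'a road set" where
  "W_set T x n = {Vertex x} \<union> (\<Union>y\<in>succs T x. seg x y ` {0..<1 / real n})"

text \<open>For a vertex of a Hausdorff tree, exactly one of the three families is nonempty.\<close>

fun nbhd_base :: "'a::order set \<Rightarrow> 'a road \<Rightarrow> 'a road set set" where
  "nbhd_base T (Edge x y t) = {seg x y ` V | V. open V \<and> t \<in> V \<and> V \<subseteq> {0<..<1}}"
| "nbhd_base T (Vertex x) =
     {W_set T x n \<union> seg z x ` {1 - 1 / real n<..1} | z n. z \<in> T \<and> x \<in> succs T z \<and> n \<ge> 1} \<union>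
     {W_set T x n | n. minimal_in T x \<and> n \<ge> 1} \<union>
     {{p \<in> road_points T. road_less (Vertex z) p \<and> road_le p (Vertex x)} \<union>
        \<Union>{W_set T w n | w. w \<in> T \<and> z < w \<and> w \<le> x}
      | z n. limit_level T x \<and> z \<in> T \<and> z < x \<and> n \<ge> 1}"

text \<open>For every Hausdorff tree this is a topology (\<open>istopology_road_open\<close>) with carrier
  \<open>road_points T\<close> (\<open>topspace_road_space\<close>), and the members of \<open>nbhd_base\<close> are themselves open
  (\<open>road_open_nbhd_base\<close>), so that they do form neighbourhood bases.\<close>

definition road_open :: "'a::order set \<Rightarrow> 'a road set \<Rightarrow> bool" where
  "road_open T U \<longleftrightarrow> U \<subseteq> road_points T \<and> (\<forall>p\<in>U. \<exists>N\<in>nbhd_base T p. N \<subseteq> U)"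

definition road_space :: "'a::order set \<Rightarrow> 'a road topology" where
  "road_space T = topology (road_open T)"

section \<open>Well-definedness of the topology\<close>

lemma tree_preds_linear:
  assumes "hausdorff_tree T" "x \<in> T" "a \<in> T" "b \<in> T" "a < x" "b < x"
  shows "a \<le> b \<or> b \<le> a"
proof -
  have "well_order_on (preds T x) {(a, b) \<in> preds T x \<times> preds T x. a \<le> b}"
    using assms unfolding hausdorff_tree_def by blast
  then have "total_on (preds T x) {(a, b) \<in> preds T x \<times> preds T x. a \<le> b}"
    unfolding well_order_on_def linear_order_on_def by blast
  then show ?thesis using assms unfolding total_on_def preds_def by fastforce
qed

lemma succs_unique:
  assumes "hausdorff_tree T" "z \<in> T" "z' \<in> T" "x \<in> succs T z" "x \<in> succs T z'"
  shows "z = z'"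
  using tree_preds_linear[of T x z z'] assms unfolding succs_def
  by (auto simp: order.order_iff_strict)

lemma vertex_cases:
  assumes "x \<in> T"
  obtains (minimal) "minimal_in T x" | (succ) z where "z \<in> T" "x \<in> succs T z" | (limit) "limit_level T x"
proof (cases "preds T x = {}")
  case True
  then show ?thesis using assms minimal unfolding minimal_in_def preds_def by blast
next
  case ne: False
  show ?thesis
  proof (cases "limit_level T x")
    case False
    then obtain m where m: "m \<in> preds T x" "\<forall>y\<in>preds T x. y \<le> m"
      using ne assms unfolding limit_level_def by blast
    then have "x \<in> succs T m" using assms unfolding succs_def preds_def by fastforce
    then show ?thesis using m succ unfolding preds_def by blast
  qed (use limit in blast)
qed

lemma minimal_not_succ: "minimal_in T x \<Longrightarrow> z \<in> T \<Longrightarrow> x \<notin> succs T z"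
  by (auto simp: minimal_in_def succs_def)

lemma minimal_not_limit: "minimal_in T x \<Longrightarrow> \<not> limit_level T x"
  by (auto simp: minimal_in_def limit_level_def preds_def)

lemma limit_not_succ:
  assumes "hausdorff_tree T" "limit_level T x" "z \<in> T"
  shows "x \<notin> succs T z"
proof
  assume x: "x \<in> succs T z"
  then have "\<forall>y\<in>preds T x. y \<le> z"
    using tree_preds_linear[OF assms(1), of x _ z] assms(3)
    unfolding succs_def preds_def by (auto simp: order.order_iff_strict)
  moreover have "z \<in> preds T x" using x assms(3) by (auto simp: succs_def preds_def)
  ultimately show False using assms(2) unfolding limit_level_def by blast
qed

lemma W_mono: "1 \<le> m \<Longrightarrow> m \<le> n \<Longrightarrow> W_set T x n \<subseteq> W_set T x m"
proof -
  assume "1 \<le> m" "m \<le> n"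
  then have "{0..<1 / real n} \<subseteq> {0..<1 / real m}"
    by (auto intro: order.strict_trans2 simp: frac_le)
  then show ?thesis unfolding W_set_def by blast
qed

lemma left_mono: "1 \<le> m \<Longrightarrow> m \<le> n \<Longrightarrow> {1 - 1 / real n<..1} \<subseteq> {1 - 1 / real m<..1}"
proof -
  assume "1 \<le> m" "m \<le> n"
  then have "1 / real n \<le> 1 / real m" by (simp add: frac_le)
  then show ?thesis by auto
qed

lemma nbhd_base_directed:
  assumes tr: "hausdorff_tree T" and p: "p \<in> road_points T"
    and N: "N \<in> nbhd_base T p" "N' \<in> nbhd_base T p"
  shows "\<exists>M\<in>nbhd_base T p. M \<subseteq> N \<inter> N'"
proof (cases p)
  case (Edge x y t)
  then obtain V V' where "N = seg x y ` V" "open V" "t \<in> V" "V \<subseteq> {0<..<1}"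
    "N' = seg x y ` V'" "open V'" "t \<in> V'" "V' \<subseteq> {0<..<1}" using N by auto
  then show ?thesis unfolding Edge nbhd_base.simps
    by (intro bexI[of _ "seg x y ` (V \<inter> V')"]) (auto intro!: exI[of _ "V \<inter> V'"])
next
  case (Vertex x)
  then have "x \<in> T" using p by (auto simp: road_points_def)
  then show ?thesis
  proof (cases rule: vertex_cases)
    case minimal
    then obtain m n where "N = W_set T x m" "N' = W_set T x n" "m \<ge> 1" "n \<ge> 1"
      using N minimal_not_succ[OF minimal] minimal_not_limit[OF minimal] unfolding Vertex by auto
    then have "W_set T x (max m n) \<subseteq> N \<inter> N'"
      using W_mono[of m "max m n" T x] W_mono[of n "max m n" T x] by simp
    moreover have "W_set T x (max m n) \<in> nbhd_base T p"
      using minimal \<open>m \<ge> 1\<close> unfolding Vertex by auto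
    ultimately show ?thesis by blast
  next
    case (succ z)
    then have only: "\<not> limit_level T x" "\<not> minimal_in T x" "\<And>z'. z' \<in> T \<Longrightarrow> x \<in> succs T z' \<Longrightarrow> z' = z"
      using limit_not_succ[OF tr] minimal_not_succ succs_unique[OF tr] by blast+
    have "\<exists>k. K = W_set T x k \<union> seg z x ` {1 - 1 / real k<..1} \<and> k \<ge> 1"
      if "K \<in> nbhd_base T p" for K
      using that only(1,2) unfolding Vertex nbhd_base.simps by (auto dest: only(3))
    then obtain m n where mn: "N = W_set T x m \<union> seg z x ` {1 - 1 / real m<..1}"
      "N' = W_set T x n \<union> seg z x ` {1 - 1 / real n<..1}" "m \<ge> 1" "n \<ge> 1"
      using N by meson
    let ?M = "W_set T x (max m n) \<union> seg z x ` {1 - 1 / real (max m n)<..1}"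
    have "W_set T x (max m n) \<subseteq> W_set T x k \<and> {1 - 1 / real (max m n)<..1} \<subseteq> {1 - 1 / real k<..1}"
      if "k = m \<or> k = n" for k
      using that mn(3,4) by (intro conjI W_mono left_mono) auto
    then have "?M \<subseteq> N \<inter> N'" unfolding mn(1,2) by (intro Int_greatest Un_mono image_mono) simp_all
    moreover have "?M \<in> nbhd_base T p"
      using succ \<open>m \<ge> 1\<close> unfolding Vertex nbhd_base.simps
      by (intro UnI1 CollectI exI[of _ z] exI[of _ "max m n"]) auto
    ultimately show ?thesis by blast
  next
    case limit
    let ?B = "\<lambda>z n. {p \<in> road_points T. road_less (Vertex z) p \<and> road_le p (Vertex x)} \<union>
        \<Union>{W_set T w n | w. w \<in> T \<and> z < w \<and> w \<le> x}"
    have nm: "\<not> minimal_in T x" using limit minimal_not_limit by blast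
    have "\<exists>z n. K = ?B z n \<and> z \<in> T \<and> z < x \<and> n \<ge> 1" if "K \<in> nbhd_base T p" for K
      using that limit_not_succ[OF tr limit] nm unfolding Vertex nbhd_base.simps by blast
    then obtain z z' m n where N': "N = ?B z m" "z \<in> T" "z < x" "m \<ge> 1"
      "N' = ?B z' n" "z' \<in> T" "z' < x" "n \<ge> 1" using N by meson
    obtain u where u: "u \<in> T" "u < x" "z \<le> u" "z' \<le> u"
      using tree_preds_linear[OF tr \<open>x \<in> T\<close>, of z z'] N' by blast
    have less: "road_less (Vertex v) q" if "v \<le> u" "road_less (Vertex u) q" for v q
      using that by (cases q) auto
    have sub: "?B u (max m n) \<subseteq> ?B v k" if "v \<le> u" "1 \<le> k" "k \<le> max m n" for v k
    proof -
      have "W_set T w (max m n) \<subseteq> ?B v k" if "w \<in> T" "u < w" "w \<le> x" for w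
        using W_mono[of k "max m n" T w] that \<open>v \<le> u\<close> \<open>1 \<le> k\<close> \<open>k \<le> max m n\<close> by fastforce
      then show ?thesis using less[OF \<open>v \<le> u\<close>] by blast
    qed
    have "?B u (max m n) \<subseteq> N \<inter> N'" unfolding N'(1,5) using sub u N'(4,8) by simp
    moreover have "?B u (max m n) \<in> nbhd_base T p"
      unfolding Vertex nbhd_base.simps
      by (intro UnI2 CollectI exI[of _ u] exI[of _ "max m n"]) (use u limit N' in auto)
    ultimately show ?thesis by blast
  qed
qed

lemma istopology_road_open:
  assumes "hausdorff_tree T"
  shows "istopology (road_open T)"
  unfolding istopology_def
proof (intro conjI allI impI)
  fix U V assume U: "road_open T U" and V: "road_open T V"
  have "\<exists>M\<in>nbhd_base T p. M \<subseteq> U \<inter> V" if p: "p \<in> U \<inter> V" for p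
  proof -
    obtain N N' where "N \<in> nbhd_base T p" "N \<subseteq> U" "N' \<in> nbhd_base T p" "N' \<subseteq> V"
      using p U V unfolding road_open_def by blast
    moreover have "p \<in> road_points T" using p U unfolding road_open_def by blast
    ultimately show ?thesis using nbhd_base_directed[OF assms, of p N N'] by blast
  qed
  then show "road_open T (U \<inter> V)" using U unfolding road_open_def by blast
next
  fix K assume "\<forall>U\<in>K. road_open T U"
  then show "road_open T (\<Union>K)" unfolding road_open_def by (meson UnionE Union_least Union_upper order_trans)
qed

lemma openin_road_space:
  "hausdorff_tree T \<Longrightarrow> openin (road_space T) U \<longleftrightarrow> road_open T U"
  unfolding road_space_def by (simp add: istopology_road_open)

lemma seg_in_road_points:
  "x \<in> T \<Longrightarrow> y \<in> succs T x \<Longrightarrow> t \<in> {0..1} \<Longrightarrow> seg x y t \<in> road_points T"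
  by (auto simp: seg_def road_points_def succs_def)

lemma W_subset:
  assumes "x \<in> T"
  shows "W_set T x n \<subseteq> road_points T"
proof -
  have "1 / real n \<le> 1" by (cases n) auto
  then have "{0..<1 / real n} \<subseteq> {0..1}" by auto
  then have "seg x y ` {0..<1 / real n} \<subseteq> road_points T" if "y \<in> succs T x" for y
    using seg_in_road_points[OF assms that] by blast
  moreover have "Vertex x \<in> road_points T" using assms by (simp add: road_points_def)
  ultimately show ?thesis unfolding W_set_def by blast
qed

lemma nbhd_base_subset:
  assumes "p \<in> road_points T" "N \<in> nbhd_base T p"
  shows "N \<subseteq> road_points T"
proof (cases p)
  case (Edge x y t)
  then have xy: "x \<in> T" "y \<in> succs T x" using assms by (auto simp: road_points_def)
  obtain V where "N = seg x y ` V" "V \<subseteq> {0<..<1}" using assms(2) unfolding Edge by auto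
  then show ?thesis using seg_in_road_points[OF xy] by force
next
  case (Vertex x)
  then have x: "x \<in> T" using assms by (auto simp: road_points_def)
  have "seg z x ` {1 - 1 / real n<..1} \<subseteq> road_points T"
    if "z \<in> T" "x \<in> succs T z" "n \<ge> 1" for z n
  proof -
    have "1 / real n \<le> 1" using that(3) by simp
    then have "{1 - 1 / real n<..1} \<subseteq> {0..1}" by auto
    then show ?thesis using seg_in_road_points[OF that(1,2)] by blast
  qed
  then show ?thesis using assms(2) x W_subset[of _ T] unfolding Vertex nbhd_base.simps by blast
qed

lemma nbhd_base_nonempty:
  assumes "p \<in> road_points T"
  shows "nbhd_base T p \<noteq> {}"
proof (cases p)
  case (Edge x y t)
  then have "0 < t" "t < 1" using assms by (auto simp: road_points_def)
  then have "seg x y ` {0<..<1} \<in> nbhd_base T p" unfolding Edge nbhd_base.simps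
    by (intro CollectI exI[of _ "{0<..<1}"]) auto
  then show ?thesis by blast
next
  case (Vertex x)
  then have "x \<in> T" using assms by (auto simp: road_points_def)
  then show ?thesis
  proof (cases rule: vertex_cases)
    case minimal
    then have "W_set T x 1 \<in> nbhd_base T p" unfolding Vertex by auto
    then show ?thesis by blast
  next
    case (succ z)
    then have "W_set T x 1 \<union> seg z x ` {1 - 1 / real 1<..1} \<in> nbhd_base T p"
      unfolding Vertex nbhd_base.simps by (intro UnI1 CollectI exI[of _ z] exI[of _ 1]) auto
    then show ?thesis by blast
  next
    case limit
    then obtain z where z: "z \<in> T" "z < x" unfolding limit_level_def preds_def by blast
    have "{p \<in> road_points T. road_less (Vertex z) p \<and> road_le p (Vertex x)} \<union>
        \<Union>{W_set T w 1 | w. w \<in> T \<and> z < w \<and> w \<le> x} \<in> nbhd_base T p"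
      unfolding Vertex nbhd_base.simps
      by (intro UnI2 CollectI exI[of _ z] exI[of _ 1]) (use z limit in auto)
    then show ?thesis by blast
  qed
qed

lemma topspace_road_space:
  assumes "hausdorff_tree T"
  shows "topspace (road_space T) = road_points T"
proof -
  have "road_open T (road_points T)"
    unfolding road_open_def
  proof (intro conjI ballI order_refl)
    fix p assume p: "p \<in> road_points T"
    then obtain N where "N \<in> nbhd_base T p" using nbhd_base_nonempty by blast
    then show "\<exists>N\<in>nbhd_base T p. N \<subseteq> road_points T" using nbhd_base_subset p by blast
  qed
  then show ?thesis
    unfolding topspace_def openin_road_space[OF assms] by (auto simp: road_open_def)
qed

lemma seg_nbhd:
  assumes "x \<in> T" "0 \<le> a" "b \<le> 1" "a < t" "t < b" "seg x y ` {a<..<b} \<subseteq> N"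
  shows "\<exists>M\<in>nbhd_base T (seg x y t). M \<subseteq> N"
proof -
  have "seg x y t = Edge x y t" using assms by (simp add: seg_def)
  moreover have "seg x y ` {a<..<b} \<in> nbhd_base T (Edge x y t)"
    unfolding nbhd_base.simps using assms by (intro CollectI exI[of _ "{a<..<b}"]) auto
  ultimately show ?thesis using assms by auto
qed

lemma W_nbhd:
  assumes "x \<in> T" "n \<ge> 1" "q \<in> W_set T x n" "q \<noteq> Vertex x"
  shows "\<exists>M\<in>nbhd_base T q. M \<subseteq> W_set T x n"
proof -
  obtain y t where q: "y \<in> succs T x" "q = seg x y t" "t \<in> {0..<1 / real n}"
    using assms unfolding W_set_def by blast
  then have "t \<noteq> 0" using assms(4) by (auto simp: seg_def)
  moreover have "seg x y ` {0<..<1 / real n} \<subseteq> W_set T x n" using q(1) unfolding W_set_def by force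
  ultimately show ?thesis unfolding q(2)
    using assms q by (intro seg_nbhd[of x T 0 "1 / real n"]) auto
qed

lemma road_open_nbhd_base:
  assumes tr: "hausdorff_tree T" and p: "p \<in> road_points T" and N: "N \<in> nbhd_base T p"
  shows "road_open T N"
  unfolding road_open_def
proof (intro conjI ballI)
  show "N \<subseteq> road_points T" using nbhd_base_subset p N by blast
next
  fix q assume q: "q \<in> N"
  show "\<exists>M\<in>nbhd_base T q. M \<subseteq> N"
  proof (cases p)
    case (Edge x y t)
    then obtain V where V: "N = seg x y ` V" "open V" "V \<subseteq> {0<..<1}" using N by auto
    then obtain s where s: "s \<in> V" "q = seg x y s" using q by blast
    have "s \<in> {0<..<1}" using s(1) V(3) by blast
    then have "q = Edge x y s" using s(2) by (simp add: seg_def)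
    moreover have "N \<in> nbhd_base T (Edge x y s)"
      unfolding nbhd_base.simps using V s(1) by blast
    ultimately have "N \<in> nbhd_base T q" by simp
    then show ?thesis by blast
  next
    case (Vertex x)
    then have x: "x \<in> T" using p by (auto simp: road_points_def)
    consider (succ) z n where "N = W_set T x n \<union> seg z x ` {1 - 1 / real n<..1}" "z \<in> T"
        "x \<in> succs T z" "n \<ge> 1"
      | (minimal) n where "N = W_set T x n" "minimal_in T x" "n \<ge> 1"
      | (limit) z n where "N = {p \<in> road_points T. road_less (Vertex z) p \<and> road_le p (Vertex x)} \<union>
        \<Union>{W_set T w n | w. w \<in> T \<and> z < w \<and> w \<le> x}" "limit_level T x" "z \<in> T" "z < x" "n \<ge> 1"
      using N unfolding Vertex nbhd_base.simps
      by (elim UnE CollectE exE conjE) (rule that; assumption)+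
    then show ?thesis
    proof cases
      case succ
      show ?thesis
      proof (cases "q = Vertex x")
        case True
        then show ?thesis using N Vertex by blast
      next
        case nx: False
        show ?thesis
        proof (cases "q \<in> W_set T x n")
          case True
          then show ?thesis using W_nbhd[OF x succ(4) True nx] succ(1) by blast
        next
          case False
          then obtain s where s: "q = seg z x s" "s \<in> {1 - 1 / real n<..1}" using q succ(1) by blast
          then have "s \<noteq> 1" using nx by (auto simp: seg_def)
          moreover have "seg z x ` {1 - 1 / real n<..<1} \<subseteq> N" unfolding succ(1) by force
          ultimately show ?thesis unfolding s(1) using s(2) succ
            by (intro seg_nbhd[of z T "1 - 1 / real n" 1]) auto
        qed
      qed
    next
      case minimal
      show ?thesis
      proof (cases "q = Vertex x")
        case True
        then show ?thesis using N Vertex by blast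
      next
        case False
        then show ?thesis using W_nbhd[OF x minimal(3)] q unfolding minimal(1) by blast
      qed
    next
      case limit
      have WN: "W_set T w n \<subseteq> N" if "w \<in> T" "z < w" "w \<le> x" for w
        unfolding limit(1) using that by blast
      have between: "seg u v ` {a<..<1} \<subseteq> N"
        if "0 \<le> a" "u \<in> T" "v \<in> succs T u" "z \<le> u" "v \<le> x" for u v a
      proof -
        have "seg u v s \<in> N" if "s \<in> {a<..<1}" for s
        proof -
          have "seg u v s = Edge u v s" using that \<open>0 \<le> a\<close> by (auto simp: seg_def)
          then show ?thesis unfolding limit(1)
            using that \<open>0 \<le> a\<close> \<open>u \<in> T\<close> \<open>v \<in> succs T u\<close> \<open>z \<le> u\<close> \<open>v \<le> x\<close>
            by (auto simp: road_points_def road_le_def)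
        qed
        then show ?thesis by blast
      qed
      have vertex: "\<exists>M\<in>nbhd_base T (Vertex w). M \<subseteq> N" if w: "w \<in> T" "z < w" "w \<le> x" for w
        using w(1)
      proof (cases rule: vertex_cases)
        case minimal
        then show ?thesis using w limit(3) unfolding minimal_in_def by blast
      next
        case (succ u)
        have "u < w" using succ(2) by (simp add: succs_def)
        then have "z \<le> u"
          using tree_preds_linear[OF tr w(1) limit(3) succ(1) w(2)] succ(2) w limit(3)
          by (auto simp: succs_def order.order_iff_strict)
        then have "seg u w ` {1 - 1 / real n<..<1} \<subseteq> N"
          using between[of "1 - 1 / real n" u w] succ w limit(5) by simp
        moreover have "seg u w 1 \<in> N" using WN[OF w] by (auto simp: seg_def W_set_def)
        moreover have "{1 - 1 / real n<..1} = insert 1 {1 - 1 / real n<..<1}" using limit(5) by auto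
        ultimately have "W_set T w n \<union> seg u w ` {1 - 1 / real n<..1} \<subseteq> N" using WN[OF w] by simp
        moreover have "W_set T w n \<union> seg u w ` {1 - 1 / real n<..1} \<in> nbhd_base T (Vertex w)"
          unfolding nbhd_base.simps using succ limit(5) by blast
        ultimately show ?thesis by blast
      next
        case lim: limit
        let ?M = "{p \<in> road_points T. road_less (Vertex z) p \<and> road_le p (Vertex w)} \<union>
        \<Union>{W_set T w' n | w'. w' \<in> T \<and> z < w' \<and> w' \<le> w}"
        have "road_le r (Vertex x)" if "road_le r (Vertex w)" for r
          using that w(3) by (cases r) (auto simp: road_le_def)
        then have "?M \<subseteq> N" unfolding limit(1) using w(3) by (fastforce intro: order_trans)
        moreover have "?M \<in> nbhd_base T (Vertex w)"
          unfolding nbhd_base.simps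
          by (intro UnI2 CollectI exI[of _ z] exI[of _ n]) (use lim limit w in auto)
        ultimately show ?thesis by blast
      qed
      show ?thesis
      proof (cases "\<exists>w. w \<in> T \<and> z < w \<and> w \<le> x \<and> q \<in> W_set T w n")
        case True
        then obtain w where w: "w \<in> T" "z < w" "w \<le> x" "q \<in> W_set T w n" by blast
        then show ?thesis using vertex W_nbhd[OF w(1) limit(5) w(4)] WN by (cases "q = Vertex w") blast+
      next
        case False
        then have q': "q \<in> road_points T" "road_less (Vertex z) q" "road_le q (Vertex x)"
          using q unfolding limit(1) by blast+
        show ?thesis
        proof (cases q)
          case (Vertex w)
          then show ?thesis using q' vertex[of w] by (auto simp: road_points_def road_le_def)
        next
          case (Edge u v s)
          then have e: "u \<in> T" "v \<in> succs T u" "0 < s" "s < 1" "z \<le> u" "v \<le> x"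
            using q' by (auto simp: road_points_def road_le_def)
          then have "q = seg u v s" using Edge by (simp add: seg_def)
          then show ?thesis using seg_nbhd[of u T 0 1 s v N] between[of 0 u v] e by simp
        qed
      qed
    qed
  qed
qed

end

theory Submission
  imports Defs
begin

text \<open>A strictly increasing \<open>g\<close> on \<open>T\<close>, normalised to take the value \<open>0\<close> at the root and values below
  \<open>1\<close> elsewhere, extends linearly along the edges to a strictly increasing \<open>F\<close> on the road space.
  Let \<open>h(t, p)\<close> be the supremum of all \<open>q\<close> below \<open>p\<close> with \<open>F q \<le> t\<close>; then \<open>h(0, p)\<close> is the root and
  \<open>h(1, p) = p\<close>. As \<open>F\<close> may jump at limit levels, \<open>h(\<cdot>, p)\<close> may rest at a vertex for a while, but it
  never jumps, because the path from the root to \<open>p\<close> is densely ordered and \<open>F\<close> is strictly increasing.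
  Joint continuity holds because all sets \<open>{p. e < p}\<close> are open and every point has small
  neighbourhoods that are closed downwards as far as some smaller point.\<close>

notation road_less (infix "\<sqsubset>" 50)
notation road_le (infix "\<sqsubseteq>" 50)

lemma succs_less: "v \<in> succs T u \<Longrightarrow> u < v" and succs_in: "v \<in> succs T u \<Longrightarrow> v \<in> T"
  by (auto simp: succs_def)

lemma Vertex_in_road_points [simp]: "Vertex x \<in> road_points T \<longleftrightarrow> x \<in> T"
  by (auto simp: road_points_def)

lemma Edge_in_road_points [simp]:
  "Edge u v t \<in> road_points T \<longleftrightarrow> u \<in> T \<and> v \<in> succs T u \<and> 0 < t \<and> t < 1"
  by (auto simp: road_points_def)

lemma road_less_trans:
  assumes "q \<in> road_points T" "p \<sqsubset> q" "q \<sqsubset> r"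
  shows "p \<sqsubset> r"
proof (cases q)
  case (Edge u v t)
  then have "u < v" using assms(1) succs_less by auto
  then show ?thesis using assms(2,3) Edge by (cases p; cases r) (auto intro: order_trans less_imp_le)
next
  case (Vertex x)
  then show ?thesis using assms(2,3) by (cases p; cases r) (auto intro: order_trans less_imp_le)
qed

lemma road_less_irrefl: "p \<in> road_points T \<Longrightarrow> \<not> p \<sqsubset> p"
  by (cases p) (auto dest: succs_less)

lemma road_less_le_trans: "q \<in> road_points T \<Longrightarrow> p \<sqsubset> q \<Longrightarrow> q \<sqsubseteq> r \<Longrightarrow> p \<sqsubset> r"
  and road_le_less_trans: "q \<in> road_points T \<Longrightarrow> p \<sqsubseteq> q \<Longrightarrow> q \<sqsubset> r \<Longrightarrow> p \<sqsubset> r"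
  and road_le_trans: "q \<in> road_points T \<Longrightarrow> p \<sqsubseteq> q \<Longrightarrow> q \<sqsubseteq> r \<Longrightarrow> p \<sqsubseteq> r"
  using road_less_trans[of q T p r] by (auto simp: road_le_def)

lemma road_not_le:
  assumes "p \<in> road_points T" "q \<in> road_points T" "p \<sqsubset> q"
  shows "\<not> q \<sqsubseteq> p"
  using road_less_le_trans[of q T p p] road_less_irrefl[of p T] assms by blast

lemma road_le_refl [simp]: "p \<sqsubseteq> p"
  by (simp add: road_le_def)

lemma road_le_Vertex [simp]: "Vertex x \<sqsubseteq> Vertex y \<longleftrightarrow> x \<le> y"
  "Edge u v t \<sqsubseteq> Vertex y \<longleftrightarrow> v \<le> y" "Vertex x \<sqsubseteq> Edge u v t \<longleftrightarrow> x \<le> u"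
  by (auto simp: road_le_def)

lemma seg_less_iff:
  assumes "v \<in> succs T u" "0 \<le> a" "a \<le> 1" "0 \<le> b" "b \<le> 1"
  shows "seg u v a \<sqsubset> seg u v b \<longleftrightarrow> a < b"
  using assms succs_less[OF assms(1)] by (auto simp: seg_def)

lemma seg_le_iff:
  assumes "v \<in> succs T u" "0 \<le> a" "a \<le> 1" "0 \<le> b" "b \<le> 1"
  shows "seg u v a \<sqsubseteq> seg u v b \<longleftrightarrow> a \<le> b"
  using seg_less_iff[OF assms] succs_less[OF assms(1)] assms(2-) unfolding road_le_def
  by (auto simp: seg_def split: if_splits)

definition is_road_lub :: "'a::order set \<Rightarrow> 'a road \<Rightarrow> 'a road set \<Rightarrow> 'a road \<Rightarrow> bool" where
  "is_road_lub T p S s \<longleftrightarrow> s \<in> road_points T \<and> s \<sqsubseteq> p \<and> (\<forall>q\<in>S. q \<sqsubseteq> s) \<and>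
     (\<forall>b\<in>road_points T. b \<sqsubseteq> p \<longrightarrow> (\<forall>q\<in>S. q \<sqsubseteq> b) \<longrightarrow> s \<sqsubseteq> b)"

fun road_height :: "('a \<Rightarrow> real) \<Rightarrow> 'a road \<Rightarrow> real" where
  "road_height g (Vertex x) = g x"
| "road_height g (Edge u v t) = (1 - t) * g u + t * g v"

context
  fixes T :: "'a::order set"
  assumes tree: "hausdorff_tree T"
begin

lemma tree_linear_le:
  assumes "x \<in> T" "a \<in> T" "b \<in> T" "a \<le> x" "b \<le> x"
  shows "a \<le> b \<or> b \<le> a"
  using tree_preds_linear[OF tree assms(1-3)] assms(4,5) by (auto simp: order.order_iff_strict)

lemma tree_minimal_element:
  assumes "B \<subseteq> T" "b \<in> B"
  obtains x where "x \<in> B" "\<And>y. y \<in> B \<Longrightarrow> \<not> y < x"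
proof (cases "B \<inter> preds T b = {}")
  case True
  then show ?thesis using that[of b] assms unfolding preds_def by blast
next
  case False
  let ?r = "{(a, c) \<in> preds T b \<times> preds T b. a \<le> c}"
  have "well_order_on (preds T b) ?r"
    using tree assms unfolding hausdorff_tree_def by blast
  then have "wf (?r - Id)" unfolding well_order_on_def by blast
  from wfE_min'[OF this False] obtain x where
    x: "x \<in> B \<inter> preds T b" "\<And>y. (y, x) \<in> ?r - Id \<Longrightarrow> y \<notin> B \<inter> preds T b" by blast
  show ?thesis
  proof (rule that[of x])
    fix y assume y: "y \<in> B"
    show "\<not> y < x"
    proof
      assume "y < x"
      then have "y \<in> B \<inter> preds T b" using y x(1) assms(1) unfolding preds_def by auto
      moreover have "(y, x) \<in> ?r - Id" if "y \<in> preds T b"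
        using that x(1) less_imp_le[OF \<open>y < x\<close>] less_imp_neq[OF \<open>y < x\<close>] by simp
      ultimately show False using x(2) by blast
    qed
  qed (use x in blast)
qed

lemma minimal_below:
  assumes "x \<in> T"
  shows "\<exists>y. minimal_in T y \<and> y \<le> x"
proof -
  have "{y \<in> T. y \<le> x} \<subseteq> T" "x \<in> {y \<in> T. y \<le> x}" using assms by auto
  from tree_minimal_element[OF this] obtain y where
    y: "y \<in> {y \<in> T. y \<le> x}" "\<And>w. w \<in> {y \<in> T. y \<le> x} \<Longrightarrow> \<not> w < y" by blast
  have "\<not> w < y" if "w \<in> T" for w
  proof
    assume "w < y"
    then have "w \<le> x" using y(1) order_trans[OF less_imp_le[OF \<open>w < y\<close>]] by blast
    then show False using y(2) that \<open>w < y\<close> by blast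
  qed
  then show ?thesis unfolding minimal_in_def using y(1) by blast
qed

lemma succs_le:
  assumes "u \<in> T" "v \<in> succs T u" "w \<in> T" "u < w" "v \<le> x" "w \<le> x" "x \<in> T"
  shows "v \<le> w"
  using tree_linear_le[of x v w] assms unfolding succs_def by (auto simp: order.order_iff_strict)

lemma succ_towards:
  assumes "x \<in> T" "y \<in> T" "x < y"
  obtains v where "v \<in> succs T x" "v \<le> y"
proof -
  obtain v where v: "v \<in> {w \<in> T. x < w \<and> w \<le> y}" "\<And>w. w \<in> {w \<in> T. x < w \<and> w \<le> y} \<Longrightarrow> \<not> w < v"
    using tree_minimal_element[of "{w \<in> T. x < w \<and> w \<le> y}" y] assms by blast
  then have "v \<in> succs T x" unfolding succs_def by fastforce
  then show ?thesis using that v(1) by blast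
qed

lemma road_linear:
  assumes "p \<in> road_points T" "q \<in> road_points T" "c \<in> road_points T" "p \<sqsubseteq> c" "q \<sqsubseteq> c"
  shows "p \<sqsubseteq> q \<or> q \<sqsubset> p"
proof -
  obtain x where x: "x \<in> T" "c \<sqsubseteq> Vertex x"
  proof (cases c)
    case (Vertex x)
    then show ?thesis using that[of x] assms(3) by simp
  next
    case (Edge u v t)
    then show ?thesis using that[of v] assms(3) succs_in[of v T u] by simp
  qed
  then have le: "p \<sqsubseteq> Vertex x" "q \<sqsubseteq> Vertex x" using assms road_le_trans by blast+
  have VE: "Vertex a \<sqsubseteq> Edge u v s \<or> Edge u v s \<sqsubset> Vertex a"
    if "a \<in> T" "u \<in> T" "v \<in> succs T u" "a \<le> x" "v \<le> x" for a u v s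
  proof -
    have "u \<le> x" using that succs_less by (meson order.strict_trans2 less_imp_le)
    then show ?thesis using tree_linear_le[of x a u] succs_le[of u v a x] that x(1)
      by (auto simp: order.order_iff_strict)
  qed
  show ?thesis
  proof (cases p)
    case p: (Vertex a)
    show ?thesis
    proof (cases q)
      case (Vertex b)
      then show ?thesis using tree_linear_le[of x a b] le assms p x by (auto simp: order.order_iff_strict)
    next
      case (Edge u v s)
      then show ?thesis using VE[of a u v s] le assms p by auto
    qed
  next
    case p: (Edge u v s)
    show ?thesis
    proof (cases q)
      case (Vertex a)
      then show ?thesis using VE[of a u v s] le assms p by (auto simp: road_le_def)
    next
      case q: (Edge u' v' s')
      have e: "u \<in> T" "v \<in> succs T u" "v \<le> x" "u' \<in> T" "v' \<in> succs T u'" "v' \<le> x"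
        using assms le p q by auto
      then have uv: "u < v" "u' < v'" "v \<in> T" "v' \<in> T" using succs_less succs_in by blast+
      then have ux: "u \<le> x" "u' \<le> x" using e by auto
      then consider "u = u'" | "u < u'" | "u' < u"
        using tree_linear_le[of x u u'] e x by (auto simp: order.order_iff_strict)
      then show ?thesis
      proof cases
        case 1
        then have "v \<le> v'" "v' \<le> v" using e uv x by (metis succs_le)+
        then show ?thesis using 1 p q by (auto simp: road_le_def)
      next
        case 2
        then have "v \<le> u'" using e ux x by (metis succs_le)
        then show ?thesis using p q by (simp add: road_le_def)
      next
        case 3
        then have "v' \<le> u" using e ux x by (metis succs_le)
        then show ?thesis using p q by (simp add: road_le_def)
      qed
    qed
  qed
qed

lemma seg_between:
  assumes "p \<in> road_points T" "u \<in> T" "v \<in> succs T u" "0 \<le> a" "a \<le> 1" "0 \<le> b" "b \<le> 1"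
    and "seg u v a \<sqsubset> p" "p \<sqsubseteq> seg u v b"
  obtains c where "a < c" "c \<le> b" "p = seg u v c"
proof -
  have uv: "u < v" "v \<in> T" using assms(3) by (auto simp: succs_def)
  have "a < b"
    using road_less_le_trans[OF assms(1,8,9)] assms by (simp add: seg_less_iff)
  have pv: "p \<sqsubseteq> seg u v 1"
    by (rule road_le_trans[OF _ assms(9), of T])
      (use assms in \<open>auto simp: seg_le_iff intro!: seg_in_road_points\<close>)
  have pu: "seg u v 0 \<sqsubset> p"
    by (rule road_le_less_trans[OF _ _ assms(8), of T])
      (use assms in \<open>auto simp: seg_le_iff intro!: seg_in_road_points\<close>)
  obtain c where c: "0 < c" "c \<le> 1" "p = seg u v c"
  proof (cases p)
    case (Vertex x)
    then have "u < x" "x \<le> v" using pu pv by (auto simp: seg_def)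
    then have "x = v" using assms(1,3) Vertex by (auto simp: succs_def order.order_iff_strict)
    then show ?thesis using that[of 1] Vertex by (auto simp: seg_def)
  next
    case (Edge u' v' s)
    then have "u \<le> u'" "v' \<le> v" using pu pv by (auto simp: seg_def)
    moreover have e: "u' \<in> T" "v' \<in> succs T u'" "0 < s" "s < 1" using assms(1) Edge by auto
    moreover have "u' < v'" "v' \<in> T" using e by (auto simp: succs_def)
    ultimately have "u' = u" "v' = v"
      using assms(3) by (auto simp: succs_def order.order_iff_strict)
    then show ?thesis using that[of s] Edge e by (auto simp: seg_def)
  qed
  then show ?thesis
    using that[of c] assms seg_less_iff[of v T u a c] seg_le_iff[of v T u c b] by auto
qed

lemma seg_towards:
  assumes "p \<in> road_points T" "q \<in> road_points T" "p \<sqsubset> q"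
  obtains u v a b where "u \<in> T" "v \<in> succs T u" "0 \<le> a" "a < b" "b < 1"
    "p = seg u v a" "seg u v b \<sqsubseteq> q"
proof (cases p)
  case (Vertex x)
  then have x: "x \<in> T" using assms by simp
  show ?thesis
  proof (cases "\<exists>y\<in>T. x < y \<and> Vertex y \<sqsubseteq> q")
    case True
    then obtain y where y: "y \<in> T" "x < y" "Vertex y \<sqsubseteq> q" by blast
    obtain v where v: "v \<in> succs T x" "v \<le> y" using succ_towards[OF x y(1,2)] .
    then have "seg x v (1/2) \<sqsubseteq> q"
      using road_le_trans[OF _ _ y(3), of T] y(1) by (auto simp: seg_def)
    then show ?thesis using that[of x v 0 "1/2"] x v Vertex by (auto simp: seg_def)
  next
    case False
    then obtain v t where q: "q = Edge x v t"
      using assms Vertex by (cases q) (auto simp: order.order_iff_strict)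
    then show ?thesis using that[of x v 0 t] Vertex assms(2) by (auto simp: seg_def)
  qed
next
  case (Edge u v t)
  then have e: "u \<in> T" "v \<in> succs T u" "0 < t" "t < 1" using assms(1) by auto
  show ?thesis
  proof (cases "Vertex v \<sqsubseteq> q")
    case True
    have "Edge u v ((t + 1) / 2) \<sqsubseteq> q"
      by (rule road_le_trans[OF _ _ True, of T]) (use e succs_in in auto)
    then show ?thesis using that[of u v t "(t + 1) / 2"] e Edge by (auto simp: seg_def)
  next
    case False
    then obtain s where "q = Edge u v s" "t < s" using assms(3) Edge by (cases q) auto
    then show ?thesis using that[of u v t s] e assms(2) Edge by (auto simp: seg_def)
  qed
qed

lemma road_dense:
  assumes "p \<in> road_points T" "q \<in> road_points T" "p \<sqsubset> q"
  obtains r where "r \<in> road_points T" "p \<sqsubset> r" "r \<sqsubset> q"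
proof -
  obtain u v a b where *: "u \<in> T" "v \<in> succs T u" "0 \<le> a" "a < b" "b < 1"
    "p = seg u v a" "seg u v b \<sqsubseteq> q" using seg_towards[OF assms] .
  let ?r = "seg u v ((a + b) / 2)"
  have "?r \<in> road_points T" "seg u v b \<in> road_points T"
    using * by (auto intro!: seg_in_road_points)
  moreover have "p \<sqsubset> ?r" "?r \<sqsubset> seg u v b" using * by (auto simp: seg_less_iff)
  ultimately show ?thesis using that * road_less_le_trans by blast
qed

lemma seg_linear:
  assumes "p \<in> road_points T" "u \<in> T" "v \<in> succs T u" "0 \<le> a" "a \<le> 1" "0 \<le> b" "b \<le> 1"
    and "p \<sqsubseteq> seg u v b"
  shows "p \<sqsubseteq> seg u v a \<or> (\<exists>c. a < c \<and> c \<le> b \<and> p = seg u v c)"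
proof -
  have m: "seg u v a \<in> road_points T" "seg u v b \<in> road_points T" "Vertex v \<in> road_points T"
    using assms succs_in by (auto intro!: seg_in_road_points)
  have "seg u v a \<sqsubseteq> seg u v 1" "seg u v b \<sqsubseteq> seg u v 1" using assms by (auto simp: seg_le_iff)
  then have "seg u v a \<sqsubseteq> Vertex v" "p \<sqsubseteq> Vertex v"
    using road_le_trans[OF m(2) assms(8)] by (auto simp: seg_def)
  then have "p \<sqsubseteq> seg u v a \<or> seg u v a \<sqsubset> p" using road_linear[OF assms(1) m(1,3)] by blast
  then show ?thesis using seg_between[OF assms(1-7) _ assms(8)] by blast
qed

lemma seg_lub:
  assumes p: "p \<in> road_points T" "S \<subseteq> road_points T" "\<And>q. q \<in> S \<Longrightarrow> q \<sqsubseteq> p"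
    and uv: "u \<in> T" "v \<in> succs T u" "\<And>q. q \<in> S \<Longrightarrow> q \<sqsubseteq> Vertex v"
    and s0: "s0 \<in> S" "\<not> s0 \<sqsubseteq> Vertex u"
  shows "\<exists>s. is_road_lub T p S s"
proof -
  define C where "C = {c. 0 < c \<and> c \<le> 1 \<and> seg u v c \<in> S}"
  have SC: "q \<sqsubseteq> Vertex u \<or> (\<exists>c\<in>C. q = seg u v c)" if "q \<in> S" for q
    using seg_linear[of q u v 0 1] uv that p(2) by (force simp: C_def seg_def)
  then obtain c0 where c0: "c0 \<in> C" using s0 by blast
  have bdd: "bdd_above C" unfolding C_def by (auto intro!: bdd_aboveI[of _ 1])
  have \<sigma>: "c0 \<le> Sup C" "Sup C \<le> 1"
    using c0 bdd by (auto intro!: cSup_upper cSup_least) (auto simp: C_def)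
  have c0': "0 < c0" "c0 \<le> 1" "seg u v c0 \<in> S" using c0 by (auto simp: C_def)
  let ?s = "seg u v (Sup C)"
  have s: "?s \<in> road_points T" using uv \<sigma> c0' by (auto intro!: seg_in_road_points)
  have least: "?s \<sqsubseteq> b" if b: "b \<in> road_points T" "\<forall>q\<in>S. q \<sqsubseteq> b" for b
  proof -
    have "Vertex v \<sqsubseteq> b \<or> (\<exists>c. 0 < c \<and> c \<le> 1 \<and> b = seg u v c)"
    proof (cases "c0 = 1")
      case True
      then show ?thesis using b(2) c0' by (auto simp: seg_def)
    next
      case False
      then have "Edge u v c0 \<sqsubseteq> b" using b(2) c0' by (auto simp: seg_def)
      then have "Vertex v \<sqsubseteq> b \<or> (\<exists>c. b = Edge u v c)" by (cases b) (auto simp: road_le_def)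
      moreover have "b = seg u v c \<and> 0 < c \<and> c \<le> 1" if "b = Edge u v c" for c
        using that b(1) by (auto simp: seg_def)
      ultimately show ?thesis by blast
    qed
    then show ?thesis
    proof
      assume *: "Vertex v \<sqsubseteq> b"
      have "?s \<sqsubseteq> seg u v 1" using \<sigma> uv c0' by (simp add: seg_le_iff)
      then have "?s \<sqsubseteq> Vertex v" by (simp add: seg_def)
      then show ?thesis using * road_le_trans[of "Vertex v" T] uv succs_in[OF uv(2)] by simp
    next
      assume "\<exists>c. 0 < c \<and> c \<le> 1 \<and> b = seg u v c"
      then obtain c where c: "0 < c" "c \<le> 1" "b = seg u v c" by blast
      have "c' \<le> c" if "c' \<in> C" for c'
        using that b(2) uv c by (auto simp: C_def seg_le_iff dest!: bspec)
      then have "Sup C \<le> c" using c0 by (auto intro: cSup_least)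
      then show ?thesis using c uv \<sigma> c0' by (simp add: seg_le_iff)
    qed
  qed
  have "q \<sqsubseteq> ?s" if "q \<in> S" for q
    using SC[OF that]
  proof
    assume q: "q \<sqsubseteq> Vertex u"
    have "seg u v 0 \<sqsubseteq> ?s" using \<sigma> uv c0' by (simp add: seg_le_iff)
    then show ?thesis using q road_le_trans[of "Vertex u" T q] uv by (simp add: seg_def)
  next
    assume "\<exists>c\<in>C. q = seg u v c"
    then obtain c where c: "c \<in> C" "q = seg u v c" by blast
    then have "c \<le> Sup C" using bdd by (auto intro: cSup_upper)
    then show ?thesis using c uv \<sigma> by (auto simp: seg_le_iff C_def)
  qed
  then have "is_road_lub T p S ?s" unfolding is_road_lub_def using s least p by blast
  then show ?thesis by blast
qed

lemma limit_between:
  assumes "limit_level T x" "b \<in> road_points T" "b \<sqsubset> Vertex x"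
  obtains y where "y \<in> T" "y < x" "b \<sqsubseteq> Vertex y"
proof (cases b)
  case (Vertex y)
  then show ?thesis using that[of y] assms by simp
next
  case (Edge u v t)
  then have "v \<noteq> x" using limit_not_succ[OF tree assms(1)] assms(2) by auto
  then show ?thesis using that[of v] assms Edge succs_in[of v T u] by auto
qed

lemma road_lub_exists:
  assumes p: "p \<in> road_points T" "S \<subseteq> road_points T" "\<And>q. q \<in> S \<Longrightarrow> q \<sqsubseteq> p"
  shows "\<exists>s. is_road_lub T p S s"
proof (cases "\<exists>x\<in>T. Vertex x \<sqsubseteq> p \<and> (\<forall>q\<in>S. q \<sqsubseteq> Vertex x)")
  case True
  let ?B = "{x \<in> T. Vertex x \<sqsubseteq> p \<and> (\<forall>q\<in>S. q \<sqsubseteq> Vertex x)}"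
  obtain x where x: "x \<in> ?B" "\<And>y. y \<in> ?B \<Longrightarrow> \<not> y < x"
    using True tree_minimal_element[of ?B] by blast
  have lub: "is_road_lub T p S (Vertex x)"
    if "\<And>b. b \<in> road_points T \<Longrightarrow> \<forall>q\<in>S. q \<sqsubseteq> b \<Longrightarrow> b \<sqsubset> Vertex x \<Longrightarrow> False"
    unfolding is_road_lub_def using x(1) p that road_linear[of "Vertex x" _ p] by auto
  have "x \<in> T" using x(1) by blast
  then show ?thesis
  proof (cases rule: vertex_cases)
    case minimal
    have "\<not> b \<sqsubset> Vertex x" if "b \<in> road_points T" for b
    proof (cases b)
      case (Vertex y)
      then show ?thesis using minimal that by (auto simp: minimal_in_def)
    next
      case (Edge u v t)
      then have "u < v" "u \<in> T" using that succs_less by auto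
      then show ?thesis using minimal Edge by (auto simp: minimal_in_def)
    qed
    then show ?thesis using lub by blast
  next
    case (succ z)
    then have "z < x" by (simp add: succs_less)
    then have "Vertex z \<sqsubseteq> p" using road_le_trans[of "Vertex x" T "Vertex z" p] x(1) by auto
    then obtain s0 where "s0 \<in> S" "\<not> s0 \<sqsubseteq> Vertex z" using x(2)[of z] \<open>z < x\<close> succ by blast
    then show ?thesis using seg_lub[OF p succ] x(1) by blast
  next
    case limit
    have False if b: "b \<in> road_points T" "\<forall>q\<in>S. q \<sqsubseteq> b" "b \<sqsubset> Vertex x" for b
    proof -
      obtain y where y: "y \<in> T" "y < x" "b \<sqsubseteq> Vertex y" using limit_between[OF limit b(1,3)] .
      then have "Vertex y \<sqsubseteq> p" using road_le_trans[of "Vertex x" T "Vertex y" p] x(1) by auto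
      moreover have "\<forall>q\<in>S. q \<sqsubseteq> Vertex y" using b y road_le_trans by blast
      ultimately show False using x(2) y by blast
    qed
    then show ?thesis using lub by blast
  qed
next
  case False
  then obtain u v t where e: "p = Edge u v t" using p by (cases p) auto
  then have uv: "u \<in> T" "v \<in> succs T u" using p(1) by auto
  then obtain s0 where "s0 \<in> S" "\<not> s0 \<sqsubseteq> Vertex u" using False e by auto
  moreover have "q \<sqsubseteq> Vertex v" if "q \<in> S" for q
    using road_le_trans[OF p(1) p(3)[OF that]] e by simp
  ultimately show ?thesis using seg_lub[OF p uv] by blast
qed

lemma W_set_ge:
  assumes "x \<in> T" "q \<in> W_set T x n"
  shows "Vertex x \<sqsubseteq> q"
proof -
  have "1 / real n \<le> 1" by (cases n) auto
  then have "Vertex x \<sqsubseteq> seg x y t" if "y \<in> succs T x" "0 \<le> t" "t < 1 / real n" for y t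
    using seg_le_iff[OF that(1), of 0 t] that by (simp add: seg_def)
  then show ?thesis using assms(2) unfolding W_set_def by auto
qed

lemma W_set_downward:
  assumes "w \<in> T" "q' \<in> W_set T w n" "q \<in> road_points T" "q \<sqsubseteq> q'"
  shows "q \<in> W_set T w n \<or> q \<sqsubseteq> Vertex w"
proof -
  consider "q' = Vertex w" | y t where "y \<in> succs T w" "0 \<le> t" "t < 1 / real n" "q' = seg w y t"
    using assms(2) unfolding W_set_def by auto
  then show ?thesis
  proof cases
    case 1
    then show ?thesis using assms by simp
  next
    case 2
    moreover have "1 / real n \<le> 1" by (cases n) auto
    ultimately have "q \<sqsubseteq> Vertex w \<or> (\<exists>c. 0 < c \<and> c \<le> t \<and> q = seg w y c)"
      using seg_linear[of q w y 0 t] assms by (simp add: seg_def)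
    then show ?thesis using 2 unfolding W_set_def by force
  qed
qed

lemma road_open_greater:
  assumes e: "e \<in> road_points T"
  shows "road_open T {p \<in> road_points T. e \<sqsubset> p}"
  unfolding road_open_def
proof (intro conjI ballI)
  fix p assume "p \<in> {p \<in> road_points T. e \<sqsubset> p}"
  then have p: "p \<in> road_points T" "e \<sqsubset> p" by auto
  have seg: "\<exists>a. 0 \<le> a \<and> a < t \<and> e \<sqsubseteq> seg u v a"
    if "u \<in> T" "v \<in> succs T u" "0 < t" "t \<le> 1" "e \<sqsubset> seg u v t" for u v t
  proof -
    have "e \<sqsubseteq> seg u v 0 \<or> (\<exists>c. 0 < c \<and> c \<le> t \<and> e = seg u v c)"
      using seg_linear[OF e that(1,2), of 0 t] that(3-5) by (simp add: road_le_def)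
    then show ?thesis
    proof
      assume "\<exists>c. 0 < c \<and> c \<le> t \<and> e = seg u v c"
      then obtain c where c: "0 < c" "c \<le> t" "e = seg u v c" by blast
      then have "c < t" using that by (simp add: seg_less_iff)
      then show ?thesis using c by (intro exI[of _ c]) simp
    qed (use that in blast)
  qed
  have above: "seg u v s \<in> {p \<in> road_points T. e \<sqsubset> p}"
    if "u \<in> T" "v \<in> succs T u" "0 \<le> a" "e \<sqsubseteq> seg u v a" "a < s" "s \<le> 1" for u v a s
  proof -
    have "seg u v a \<in> road_points T" "seg u v s \<in> road_points T"
      using that by (auto intro!: seg_in_road_points)
    moreover have "seg u v a \<sqsubset> seg u v s" using that by (simp add: seg_less_iff)
    ultimately show ?thesis using road_le_less_trans that(4) by blast
  qed
  show "\<exists>N\<in>nbhd_base T p. N \<subseteq> {p \<in> road_points T. e \<sqsubset> p}"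
  proof (cases p)
    case (Edge u v t)
    then have uv: "u \<in> T" "v \<in> succs T u" "0 < t" "t < 1" "p = seg u v t"
      using p by (auto simp: seg_def)
    then obtain a where a: "0 \<le> a" "a < t" "e \<sqsubseteq> seg u v a" using seg[of u v t] p by auto
    have "seg u v ` {a<..<1} \<subseteq> {p \<in> road_points T. e \<sqsubset> p}"
      using above[of u v a] uv a by auto
    then show ?thesis unfolding uv(5) using seg_nbhd[of u T a 1 t v] uv a by blast
  next
    case (Vertex x)
    then have x: "x \<in> T" using p by simp
    have W: "W_set T w n \<subseteq> {p \<in> road_points T. e \<sqsubset> p}" if "w \<in> T" "e \<sqsubset> Vertex w" for w n
      using W_subset[OF that(1), of n] W_set_ge[OF that(1), of _ n] that
        road_less_le_trans[of "Vertex w" T e] by auto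
    show ?thesis
      using x
    proof (cases rule: vertex_cases)
      case minimal
      have "\<not> e \<sqsubset> Vertex x"
      proof (cases e)
        case (Edge u v t)
        then have "u < v" "u \<in> T" using e succs_less by auto
        then show ?thesis using minimal Edge by (auto simp: minimal_in_def)
      qed (use e minimal in \<open>auto simp: minimal_in_def\<close>)
      then show ?thesis using p Vertex by simp
    next
      case (succ z)
      then obtain a where a: "0 \<le> a" "a < 1" "e \<sqsubseteq> seg z x a"
        using seg[of z x 1] p Vertex by (auto simp: seg_def)
      obtain n where n: "1 / real (Suc n) < 1 - a"
        using reals_Archimedean[of "1 - a"] a by (auto simp: inverse_eq_divide)
      let ?N = "W_set T x (Suc n) \<union> seg z x ` {1 - 1 / real (Suc n)<..1}"
      have "seg z x s \<in> {p \<in> road_points T. e \<sqsubset> p}" if "s \<in> {1 - 1 / real (Suc n)<..1}" for s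
        by (rule above[OF succ a(1,3)]) (use that n in auto)
      then have "?N \<subseteq> {p \<in> road_points T. e \<sqsubset> p}" using W[OF x] p Vertex by blast
      moreover have "?N \<in> nbhd_base T (Vertex x)"
        unfolding nbhd_base.simps using succ
        by (intro UnI1 CollectI exI[of _ z] exI[of _ "Suc n"]) auto
      ultimately show ?thesis unfolding Vertex by blast
    next
      case limit
      obtain z where z: "z \<in> T" "z < x" "e \<sqsubseteq> Vertex z"
        using limit_between[OF limit e] p Vertex by blast
      let ?N = "{p \<in> road_points T. road_less (Vertex z) p \<and> road_le p (Vertex x)} \<union>
        \<Union>{W_set T w 1 | w. w \<in> T \<and> z < w \<and> w \<le> x}"
      have "e \<sqsubset> q" if "Vertex z \<sqsubset> q" for q
        using road_le_less_trans[OF _ z(3) that] z(1) by simp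
      then have "?N \<subseteq> {p \<in> road_points T. e \<sqsubset> p}" using W by fastforce
      moreover have "?N \<in> nbhd_base T (Vertex x)"
        unfolding nbhd_base.simps
        by (intro UnI2 CollectI exI[of _ z] exI[of _ 1]) (use z limit in auto)
      ultimately show ?thesis unfolding Vertex by blast
    qed
  qed
qed blast

lemma road_open_convex:
  assumes U: "road_open T U" "p \<in> U"
  obtains N where "road_open T N" "p \<in> N" "N \<subseteq> U"
    "(\<forall>q'\<in>N. \<forall>q\<in>road_points T. q \<sqsubseteq> q' \<longrightarrow> q \<in> N) \<or>
     (\<exists>z\<in>road_points T. z \<sqsubset> p \<and> (\<forall>q'\<in>N. \<forall>q\<in>road_points T. z \<sqsubset> q \<longrightarrow> q \<sqsubseteq> q' \<longrightarrow> q \<in> N))"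
proof -
  have p: "p \<in> road_points T" using U unfolding road_open_def by blast
  obtain N where N: "N \<in> nbhd_base T p" "N \<subseteq> U" using U unfolding road_open_def by blast
  note opn = road_open_nbhd_base[OF tree p]
  show ?thesis
  proof (cases p)
    case (Edge u v t)
    then have uv: "u \<in> T" "v \<in> succs T u" "0 < t" "t < 1" "p = seg u v t"
      using p by (auto simp: seg_def)
    obtain V where V: "N = seg u v ` V" "open V" "t \<in> V" "V \<subseteq> {0<..<1}" using N Edge by auto
    then obtain e where e: "0 < e" "ball t e \<subseteq> V" unfolding open_contains_ball by blast
    define a b where "a = t - e / 2" and "b = t + e / 2"
    have "a \<in> V" "b \<in> V" using e by (auto simp: a_def b_def dist_real_def)
    then have ab: "0 < a" "a < t" "t < b" "b < 1" using V e by (auto simp: a_def b_def)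
    have "{a<..<b} \<subseteq> V" using e by (force simp: a_def b_def dist_real_def)
    then have sub: "seg u v ` {a<..<b} \<subseteq> U" using N V by blast
    have "seg u v ` {a<..<b} \<in> nbhd_base T p"
      unfolding Edge nbhd_base.simps using ab by (intro CollectI exI[of _ "{a<..<b}"]) auto
    then have "road_open T (seg u v ` {a<..<b})" by (rule opn)
    moreover have "p \<in> seg u v ` {a<..<b}" using uv ab by auto
    moreover have "seg u v a \<in> road_points T" "seg u v a \<sqsubset> p"
      using uv ab by (auto simp: seg_less_iff intro!: seg_in_road_points)
    moreover have "q \<in> seg u v ` {a<..<b}"
      if q: "q' \<in> seg u v ` {a<..<b}" "q \<in> road_points T" "seg u v a \<sqsubset> q" "q \<sqsubseteq> q'" for q q'
    proof -
      obtain c where c: "q' = seg u v c" "a < c" "c < b" using q(1) by auto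
      then obtain d where "a < d" "d \<le> c" "q = seg u v d"
        using seg_between[of q u v a c] q uv ab by auto
      then show ?thesis using c by auto
    qed
    ultimately show ?thesis using that[of "seg u v ` {a<..<b}"] sub by blast
  next
    case (Vertex x)
    then have x: "x \<in> T" using p by simp
    have pN: "p \<in> N" using N(1) x unfolding Vertex by (auto simp: W_set_def road_le_def)
    consider (succ) z n where "N = W_set T x n \<union> seg z x ` {1 - 1 / real n<..1}" "z \<in> T"
        "x \<in> succs T z" "n \<ge> 1"
      | (minimal) n where "N = W_set T x n" "minimal_in T x" "n \<ge> 1"
      | (limit) z n where "N = {p \<in> road_points T. road_less (Vertex z) p \<and> road_le p (Vertex x)} \<union>
        \<Union>{W_set T w n | w. w \<in> T \<and> z < w \<and> w \<le> x}" "limit_level T x" "z \<in> T" "z < x" "n \<ge> 1"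
      using N(1) unfolding Vertex nbhd_base.simps
      by (elim UnE CollectE exE conjE) (rule that; assumption)+
    then have "(\<forall>q'\<in>N. \<forall>q\<in>road_points T. q \<sqsubseteq> q' \<longrightarrow> q \<in> N) \<or>
     (\<exists>z\<in>road_points T. z \<sqsubset> p \<and> (\<forall>q'\<in>N. \<forall>q\<in>road_points T. z \<sqsubset> q \<longrightarrow> q \<sqsubseteq> q' \<longrightarrow> q \<in> N))"
    proof cases
      case succ
      define a where "a = 1 - 1 / real n"
      have a: "0 \<le> a" "a < 1" using succ(4) by (auto simp: a_def)
      have px: "p = seg z x 1" using Vertex by (simp add: seg_def)
      have edge: "q \<in> N" if "q \<in> road_points T" "seg z x a \<sqsubset> q" "q \<sqsubseteq> seg z x c" "a < c" "c \<le> 1" for q c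
        using seg_between[OF that(1) succ(2,3) _ _ _ _ that(2,3)] a that(4,5)
        unfolding succ(1) a_def by force
      have "q \<in> N" if q: "q' \<in> N" "q \<in> road_points T" "seg z x a \<sqsubset> q" "q \<sqsubseteq> q'" for q q'
      proof (cases "q' \<in> W_set T x n")
        case True
        then have "q \<in> W_set T x n \<or> q \<sqsubseteq> seg z x 1"
          using W_set_downward[OF x _ q(2,4)] by (simp add: seg_def)
        then show ?thesis using edge[OF q(2,3), of 1] a succ(1) by auto
      next
        case False
        then obtain c where "a < c" "c \<le> 1" "q' = seg z x c" using q(1) succ(1) by (auto simp: a_def)
        then show ?thesis using edge q by blast
      qed
      moreover have "seg z x a \<in> road_points T" "seg z x a \<sqsubset> p"
        using a succ(2,3) px by (auto simp: seg_less_iff intro!: seg_in_road_points)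
      ultimately show ?thesis by blast
    next
      case minimal
      have "q \<in> N" if q: "q' \<in> N" "q \<in> road_points T" "q \<sqsubseteq> q'" for q q'
      proof -
        have "q \<in> N \<or> q \<sqsubseteq> Vertex x" using W_set_downward[OF x _ q(2,3)] q(1) minimal(1) by blast
        moreover have "q = Vertex x" if "q \<sqsubseteq> Vertex x"
        proof (cases q)
          case (Vertex y)
          then show ?thesis using that minimal(2) q(2) by (auto simp: minimal_in_def order.order_iff_strict)
        next
          case (Edge u v t)
          then have "u < v" "u \<in> T" "v \<le> x" using q(2) that succs_less by auto
          then show ?thesis using minimal(2) by (auto simp: minimal_in_def)
        qed
        ultimately show ?thesis using pN Vertex by blast
      qed
      then show ?thesis by blast
    next
      case limit
      have below: "q \<in> N" if "q \<in> road_points T" "Vertex z \<sqsubset> q" "q \<sqsubseteq> Vertex x" for q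
        unfolding limit(1) using that by blast
      have "q \<in> N" if q: "q' \<in> N" "q \<in> road_points T" "Vertex z \<sqsubset> q" "q \<sqsubseteq> q'" for q q'
      proof (cases "\<exists>w. w \<in> T \<and> z < w \<and> w \<le> x \<and> q' \<in> W_set T w n")
        case True
        then obtain w where w: "w \<in> T" "z < w" "w \<le> x" "q' \<in> W_set T w n" by blast
        then have "q \<in> W_set T w n \<or> q \<sqsubseteq> Vertex w" using W_set_downward q by blast
        moreover have "q \<sqsubseteq> Vertex x" if "q \<sqsubseteq> Vertex w"
          using road_le_trans[OF _ that, of T "Vertex x"] w by simp
        moreover have "W_set T w n \<subseteq> N" unfolding limit(1) using w by blast
        ultimately show ?thesis using below q by blast
      next
        case False
        then have "q' \<in> road_points T" "q' \<sqsubseteq> Vertex x" using q(1) unfolding limit(1) by blast+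
        then show ?thesis using below q road_le_trans by blast
      qed
      moreover have "Vertex z \<in> road_points T" "Vertex z \<sqsubset> p" using limit Vertex by auto
      ultimately show ?thesis by blast
    qed
    then show ?thesis using that[OF opn[OF N(1)] pN N(2)] by blast
  qed
qed

lemma road_open_towards:
  assumes U: "road_open T U" "p \<in> U" and r: "r \<in> road_points T" "p \<sqsubset> r"
  obtains q where "q \<in> U" "p \<sqsubset> q" "q \<sqsubseteq> r"
proof -
  have p: "p \<in> road_points T" using U unfolding road_open_def by blast
  obtain N where N: "N \<in> nbhd_base T p" "N \<subseteq> U" using U unfolding road_open_def by blast
  obtain u v a b where *: "u \<in> T" "v \<in> succs T u" "0 \<le> a" "a < b" "b < 1"
    "p = seg u v a" "seg u v b \<sqsubseteq> r" using seg_towards[OF p r] .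
  have "\<exists>e>0. \<forall>c. a < c \<and> c < a + e \<longrightarrow> seg u v c \<in> N"
  proof (cases "a = 0")
    case True
    then have pu: "p = Vertex u" using * by (simp add: seg_def)
    obtain n where n: "n \<ge> 1" "W_set T u n \<subseteq> N" using N(1) *(1) unfolding pu by auto
    have "seg u v c \<in> N" if "a < c" "c < a + 1 / real n" for c
      using that True n(2) *(2) unfolding W_set_def by force
    then show ?thesis using n(1) by (intro exI[of _ "1 / real n"]) auto
  next
    case False
    then have pe: "p = Edge u v a" using * by (simp add: seg_def)
    then obtain V where V: "N = seg u v ` V" "open V" "a \<in> V" using N by auto
    then obtain e where "0 < e" "ball a e \<subseteq> V" unfolding open_contains_ball by blast
    then show ?thesis using V(1) by (intro exI[of _ e]) (force simp: dist_real_def)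
  qed
  then obtain e where e: "0 < e" "\<And>c. a < c \<Longrightarrow> c < a + e \<Longrightarrow> seg u v c \<in> N" by blast
  define c where "c = min b (a + e / 2)"
  have c: "a < c" "c < a + e" "c \<le> b" using e * by (auto simp: c_def)
  have "seg u v b \<in> road_points T" "seg u v c \<sqsubseteq> seg u v b"
    using c * by (auto simp: seg_le_iff intro!: seg_in_road_points)
  then have "seg u v c \<sqsubseteq> r" using *(7) road_le_trans by blast
  moreover have "p \<sqsubset> seg u v c" using c * by (simp add: seg_less_iff)
  ultimately show ?thesis using that e(2)[OF c(1,2)] N(2) by blast
qed

lemma continuous_retraction:
  fixes F :: "'a road \<Rightarrow> real" and h :: "real \<Rightarrow> 'a road \<Rightarrow> 'a road"
  assumes F: "\<And>p q. p \<in> road_points T \<Longrightarrow> q \<in> road_points T \<Longrightarrow> p \<sqsubset> q \<Longrightarrow> F p < F q"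
    and h: "\<And>t p. t \<in> {0..1} \<Longrightarrow> p \<in> road_points T \<Longrightarrow>
      is_road_lub T p {q \<in> road_points T. q \<sqsubseteq> p \<and> F q \<le> t} (h t p)"
  shows "continuous_map (prod_topology (top_of_set {0..1}) (road_space T)) (road_space T)
    (\<lambda>(t, p). h t p)"
proof -
  note opn = openin_road_space[OF tree]
  have h_in: "h t p \<in> road_points T" and h_le: "h t p \<sqsubseteq> p"
    and h_upper: "\<And>q. q \<in> road_points T \<Longrightarrow> q \<sqsubseteq> p \<Longrightarrow> F q \<le> t \<Longrightarrow> q \<sqsubseteq> h t p"
    and h_least: "\<And>b. b \<in> road_points T \<Longrightarrow> b \<sqsubseteq> p \<Longrightarrow>
      (\<And>q. q \<in> road_points T \<Longrightarrow> q \<sqsubseteq> p \<Longrightarrow> F q \<le> t \<Longrightarrow> q \<sqsubseteq> b) \<Longrightarrow> h t p \<sqsubseteq> b"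
    if "t \<in> {0..1}" "p \<in> road_points T" for t p
    using h[OF that] unfolding is_road_lub_def by blast+
  have local: "\<exists>I P. open I \<and> t \<in> I \<and> road_open T P \<and> p \<in> P \<and>
      (\<forall>t'\<in>I \<inter> {0..1}. \<forall>p'\<in>P. h t' p' \<in> U)"
    if t: "t \<in> {0..1}" and p: "p \<in> road_points T" and U: "road_open T U" "h t p \<in> U" for t p U
  proof -
    define q where "q = h t p"
    have q: "q \<in> road_points T" "q \<sqsubseteq> p" "q \<in> U" using h_in h_le t p U by (auto simp: q_def)
    obtain N where N: "road_open T N" "q \<in> N" "N \<subseteq> U"
      "(\<forall>q'\<in>N. \<forall>q\<in>road_points T. q \<sqsubseteq> q' \<longrightarrow> q \<in> N) \<or>
       (\<exists>z\<in>road_points T. z \<sqsubset> q \<and> (\<forall>q'\<in>N. \<forall>q\<in>road_points T. z \<sqsubset> q \<longrightarrow> q \<sqsubseteq> q' \<longrightarrow> q \<in> N))"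
      using road_open_convex[OF U(1) q(3)] .
    have NP: "N \<subseteq> road_points T" using N(1) by (simp add: road_open_def)
    \<comment> \<open>Near \<open>(t, p)\<close> the value of \<open>h\<close> stays above a point \<open>z < q\<close> from which \<open>N\<close> is closed downwards ...\<close>
    obtain l A where A: "l < t" "road_open T A" "p \<in> A"
      "\<And>t' p' q'. t' \<in> {0..1} \<Longrightarrow> l < t' \<Longrightarrow> p' \<in> A \<Longrightarrow> q' \<in> N \<Longrightarrow> h t' p' \<sqsubseteq> q' \<Longrightarrow> h t' p' \<in> N"
      using N(4)
    proof
      assume "\<forall>q'\<in>N. \<forall>q\<in>road_points T. q \<sqsubseteq> q' \<longrightarrow> q \<in> N"
      moreover have "road_open T (road_points T)"
        using opn openin_topspace[of "road_space T"] topspace_road_space[OF tree] by simp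
      ultimately show thesis using that[of "t - 1" "road_points T"] h_in p by force
    next
      assume "\<exists>z\<in>road_points T. z \<sqsubset> q \<and>
        (\<forall>q'\<in>N. \<forall>q\<in>road_points T. z \<sqsubset> q \<longrightarrow> q \<sqsubseteq> q' \<longrightarrow> q \<in> N)"
      then obtain z where z: "z \<in> road_points T" "z \<sqsubset> q"
        "\<And>q' q. q' \<in> N \<Longrightarrow> q \<in> road_points T \<Longrightarrow> z \<sqsubset> q \<Longrightarrow> q \<sqsubseteq> q' \<Longrightarrow> q \<in> N" by blast
      obtain y where y: "y \<in> road_points T" "z \<sqsubset> y" "y \<sqsubset> q" using road_dense[OF z(1) q(1) z(2)] .
      have yp: "y \<sqsubset> p" using road_less_le_trans[OF q(1) y(3) q(2)] .
      have "\<not> q \<sqsubseteq> y" using road_not_le[OF y(1) q(1) y(3)] .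
      then obtain s where s: "s \<in> road_points T" "s \<sqsubseteq> p" "F s \<le> t" "\<not> s \<sqsubseteq> y"
        using h_least[OF t p y(1)] yp unfolding q_def road_le_def by blast
      then have "y \<sqsubset> s" using road_linear[OF s(1) y(1) p] yp by (auto simp: road_le_def)
      then have "F y < t" using F y(1) s by fastforce
      moreover have "h t' p' \<in> N"
        if "t' \<in> {0..1}" "F y < t'" "p' \<in> {p \<in> road_points T. y \<sqsubset> p}" "q' \<in> N" "h t' p' \<sqsubseteq> q'"
        for t' p' q'
      proof -
        have p': "p' \<in> road_points T" "y \<sqsubset> p'" using that by auto
        then have "y \<sqsubseteq> h t' p'" using h_upper[OF that(1) p'(1) y(1)] that(2) by (simp add: road_le_def)
        then have "z \<sqsubset> h t' p'" using road_less_le_trans y by blast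
        then show ?thesis using z(3) that h_in p' by blast
      qed
      ultimately show thesis
        using that[of "F y" "{p \<in> road_points T. y \<sqsubset> p}"] road_open_greater[OF y(1)] p yp by blast
    qed
    \<comment> \<open>... and below a point of \<open>N\<close>.\<close>
    obtain m B where B: "t < m" "road_open T B" "p \<in> B"
      "\<And>t' p'. t' \<in> {0..1} \<Longrightarrow> t' < m \<Longrightarrow> p' \<in> B \<Longrightarrow> \<exists>q'\<in>N. h t' p' \<sqsubseteq> q'"
    proof (cases "q = p")
      case True
      then have "\<exists>q'\<in>N. h t' p' \<sqsubseteq> q'" if "t' \<in> {0..1}" "p' \<in> N" for t' p'
        using h_le that NP by blast
      then show ?thesis using that[of "t + 1" N] N(1,2) True by simp
    next
      case False
      then have "q \<sqsubset> p" using q(2) by (auto simp: road_le_def)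
      then obtain r where r: "r \<in> road_points T" "q \<sqsubset> r" "r \<sqsubset> p" using road_dense q(1) p by blast
      obtain y where y: "y \<in> N" "q \<sqsubset> y" "y \<sqsubseteq> r" using road_open_towards[OF N(1,2) r(1,2)] .
      have yP: "y \<in> road_points T" using y NP by blast
      have yp: "y \<sqsubset> p" using road_le_less_trans[OF r(1) y(3) r(3)] .
      have "\<not> y \<sqsubseteq> q" using road_not_le[OF q(1) yP y(2)] .
      then have "t < F y" using h_upper[OF t p yP] yp unfolding q_def road_le_def by fastforce
      moreover have "h t' p' \<sqsubseteq> y"
        if "t' \<in> {0..1}" "t' < F y" "p' \<in> {p \<in> road_points T. y \<sqsubset> p}" for t' p'
      proof -
        have p': "p' \<in> road_points T" "y \<sqsubset> p'" using that by auto
        have "s \<sqsubseteq> y" if s: "s \<in> road_points T" "s \<sqsubseteq> p'" "F s \<le> t'" for s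
          using road_linear[OF s(1) yP p'(1) s(2)] F[OF yP s(1)] p'(2) s(3) \<open>t' < F y\<close>
          by (force simp: road_le_def)
        then show ?thesis using h_least[OF that(1) p'(1) yP] p'(2) by (simp add: road_le_def)
      qed
      ultimately show thesis
        using that[of "F y" "{p \<in> road_points T. y \<sqsubset> p}"] road_open_greater[OF yP] p yp y(1) by blast
    qed
    have "road_open T (A \<inter> B)" using A(2) B(2) openin_Int unfolding opn[symmetric] by blast
    moreover have "h t' p' \<in> U" if "t' \<in> {l<..<m} \<inter> {0..1}" "p' \<in> A \<inter> B" for t' p'
      using A(4)[of t' p'] B(4)[of t' p'] that N(3) by auto
    ultimately show ?thesis using A B by (intro exI[of _ "{l<..<m}"] exI[of _ "A \<inter> B"]) auto
  qed
  let ?X = "prod_topology (top_of_set {0..1::real}) (road_space T)"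
  have top: "topspace ?X = {0..1} \<times> road_points T" using topspace_road_space[OF tree] by simp
  have "openin ?X {x \<in> topspace ?X. (case x of (t, p) \<Rightarrow> h t p) \<in> U}"
    if U: "openin (road_space T) U" for U
  proof (subst openin_subopen, intro ballI)
    fix x assume "x \<in> {x \<in> topspace ?X. (case x of (t, p) \<Rightarrow> h t p) \<in> U}"
    then obtain t p where x: "x = (t, p)" "t \<in> {0..1}" "p \<in> road_points T" "h t p \<in> U"
      unfolding top by auto
    then obtain I P where IP: "open I" "t \<in> I" "road_open T P" "p \<in> P"
      "\<And>t' p'. t' \<in> I \<inter> {0..1} \<Longrightarrow> p' \<in> P \<Longrightarrow> h t' p' \<in> U"
      using local[of t p U] U unfolding opn by blast
    have "openin ?X (({0..1} \<inter> I) \<times> P)"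
      using IP unfolding openin_prod_Times_iff opn by (auto simp: openin_open)
    moreover have "P \<subseteq> road_points T" using IP(3) by (simp add: road_open_def)
    ultimately show "\<exists>W. openin ?X W \<and> x \<in> W \<and>
        W \<subseteq> {x \<in> topspace ?X. (case x of (t, p) \<Rightarrow> h t p) \<in> U}"
      using IP x unfolding top by (intro exI[of _ "({0..1} \<inter> I) \<times> P"]) auto
  qed
  then show ?thesis
    unfolding continuous_map_def top topspace_road_space[OF tree] using h_in by auto
qed

lemma road_height_strict_mono:
  assumes g: "strict_mono_on T g" and pq: "p \<in> road_points T" "q \<in> road_points T" "p \<sqsubset> q"
  shows "road_height g p < road_height g q"
proof -
  have le: "g x \<le> g y" if "x \<in> T" "y \<in> T" "x \<le> y" for x y
    using g that by (auto simp: strict_mono_on_def order.order_iff_strict)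
  have lt: "g x < g y" if "x \<in> T" "y \<in> T" "x < y" for x y
    using g that by (auto simp: strict_mono_on_def)
  have edge: "g u < road_height g (Edge u v t)" "road_height g (Edge u v t) < g v"
    "t < s \<Longrightarrow> road_height g (Edge u v t) < road_height g (Edge u v s)"
    if "Edge u v t \<in> road_points T" for u v t s
  proof -
    have uv: "g u < g v" "0 < t" "t < 1" using that lt[of u v] succs_less[of v T u] succs_in[of v T u] by auto
    have *: "road_height g (Edge u v r) = g u + r * (g v - g u)" for r by (simp add: algebra_simps)
    show "g u < road_height g (Edge u v t)" unfolding * using uv by simp
    have "t * (g v - g u) < 1 * (g v - g u)" using uv by (intro mult_strict_right_mono) auto
    then show "road_height g (Edge u v t) < g v" unfolding * by simp
    show "road_height g (Edge u v t) < road_height g (Edge u v s)" if "t < s"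
      unfolding * using uv that by simp
  qed
  show ?thesis
  proof (cases p)
    case p: (Vertex x)
    show ?thesis
    proof (cases q)
      case (Vertex y)
      then show ?thesis using p pq lt by simp
    next
      case (Edge u v t)
      then show ?thesis using p pq le[of x u] edge(1)[of u v t] by simp
    qed
  next
    case p: (Edge u v t)
    then have v: "v \<in> T" using pq(1) succs_in[of v T u] by simp
    show ?thesis
    proof (cases q)
      case (Vertex y)
      then show ?thesis using p pq v le[of v y] edge(2)[of u v t] by simp
    next
      case (Edge u' v' s)
      then show ?thesis
        using p pq v le[of v u'] edge(2)[of u v t] edge(1)[of u' v' s] edge(3)[of u v t s] by auto
    qed
  qed
qed

end

lemma R_special_unit:
  assumes "R_special T" and r: "r \<in> T" "\<And>x. x \<in> T \<Longrightarrow> r \<le> x"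
  obtains g :: "'a::order \<Rightarrow> real" where "strict_mono_on T g" "g r = 0" "\<And>x. x \<in> T \<Longrightarrow> g x < 1"
proof -
  obtain f :: "'a \<Rightarrow> real" where f: "strict_mono_on T f" using assms(1) unfolding R_special_def by blast
  define d where "d x = f x - f r" for x
  have d0: "0 \<le> d x" if "x \<in> T" for x
    using f r that unfolding d_def strict_mono_on_def by (auto simp: order.order_iff_strict)
  have "d x / (1 + d x) < d y / (1 + d y)" if "x \<in> T" "y \<in> T" "x < y" for x y
  proof -
    have "d x < d y" using f that by (simp add: d_def strict_mono_on_def)
    then show ?thesis using d0[OF that(1)] d0[OF that(2)] by (simp add: divide_simps algebra_simps)
  qed
  then have "strict_mono_on T (\<lambda>x. d x / (1 + d x))" by (simp add: strict_mono_on_def)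
  moreover have "d x / (1 + d x) < 1" if "x \<in> T" for x using d0[OF that] by (simp add: divide_simps)
  ultimately show ?thesis using that[of "\<lambda>x. d x / (1 + d x)"] by (simp add: d_def)
qed

theorem theorem1p1:
  fixes T :: "'a::order set"
  assumes "hausdorff_tree T" and "rooted T" and "R_special T"
  shows "contractible_space (road_space T)"
proof -
  note tree = assms(1)
  obtain r where r: "minimal_in T r" "\<And>x. minimal_in T x \<Longrightarrow> x = r"
    using assms(2) unfolding rooted_def by blast
  have rT: "r \<in> T" using r(1) by (simp add: minimal_in_def)
  have r_le: "r \<le> x" if x: "x \<in> T" for x
    using minimal_below[OF tree x] r(2) by blast
  obtain g :: "'a \<Rightarrow> real" where g: "strict_mono_on T g" "g r = 0" "\<And>x. x \<in> T \<Longrightarrow> g x < 1"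
    using R_special_unit[OF assms(3) rT r_le] by blast
  note F = road_height_strict_mono[OF tree g(1)]
  have root: "Vertex r \<sqsubseteq> p" if "p \<in> road_points T" for p
    using that r_le by (cases p) auto
  have F1: "road_height g p \<le> 1" if p: "p \<in> road_points T" for p
  proof (cases p)
    case (Vertex x)
    then show ?thesis using p g(3)[of x] by simp
  next
    case (Edge u v t)
    then have "road_height g p < g v" "g v < 1"
      using F[OF p, of "Vertex v"] p g(3)[of v] succs_in[of v T u] by auto
    then show ?thesis by simp
  qed
  let ?S = "\<lambda>t p. {q \<in> road_points T. q \<sqsubseteq> p \<and> road_height g q \<le> t}"
  define h where "h t p = (SOME s. is_road_lub T p (?S t p) s)" for t p
  have h: "is_road_lub T p (?S t p) (h t p)" if "p \<in> road_points T" for t p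
    unfolding h_def by (rule someI_ex, rule road_lub_exists[OF tree that]) auto
  have "h 0 p = Vertex r" if p: "p \<in> road_points T" for p
  proof -
    have "q \<sqsubseteq> Vertex r" if "q \<in> ?S 0 p" for q
      using that F[of "Vertex r" q] root[of q] rT g(2) by (force simp: road_le_def)
    then have "h 0 p \<sqsubseteq> Vertex r" "h 0 p \<in> road_points T"
      using h[OF p, of 0] root[OF p] rT unfolding is_road_lub_def by auto
    then show ?thesis using root[of "h 0 p"] road_not_le[of "Vertex r" T "h 0 p"] rT
      by (auto simp: road_le_def[of "Vertex r"])
  qed
  moreover have "h 1 p = p" if p: "p \<in> road_points T" for p
  proof -
    have "p \<sqsubseteq> h 1 p" "h 1 p \<sqsubseteq> p" "h 1 p \<in> road_points T"
      using h[OF p, of 1] F1[OF p] p unfolding is_road_lub_def by auto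
    then show ?thesis using road_not_le[OF p, of "h 1 p"] by (auto simp: road_le_def)
  qed
  moreover have "continuous_map (prod_topology (top_of_set {0..1}) (road_space T)) (road_space T)
      (\<lambda>(t, p). h t p)"
    by (rule continuous_retraction[OF tree, of "road_height g"]) (use F h in blast)+
  ultimately have "homotopic_with (\<lambda>_. True) (road_space T) (road_space T) (\<lambda>_. Vertex r) id"
    using topspace_road_space[OF tree]
    by (subst homotopic_with) (auto intro!: exI[of _ "\<lambda>(t, p). h t p"])
  then show ?thesis unfolding contractible_space_def using homotopic_with_symD by blast
qed

end
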